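(* Let $F$ and $G'$ be graphs, let $X=G'\square_\sigma F$ be an $F$-bundle over $G'$, and let $G'_{\mathrm{hor}}$ be the horizontal subgraph of $X$. Assume that for all triangles $xyzx$ of $G'$ and all $u\in V(F)$, $u\not\sim_F\sigma_{xyzx}(u)$, where $\sigma_{xyzx}=\sigma_{zx}\circ\sigma_{yz}\circ\sigma_{xy}$. Then for every vertex $P=(x,u)\in V(X)$ the curvature matrix decomposes as $$A_\infty^{X}(P)=A_\infty^{F}(u)\oplus A_\infty^{G'_{\mathrm{hor}}}(P),$$ with respect to the partition of the neighbours of $P$ in $X$ into $\mathcal{F}_P=\{(x,v):v\sim_F u\}$ (identified with the neighbours of $u$ in $F$) and $\mathcal{H}_P=\{(y,\sigma_{xy}(u)):y\sim_{G'}x\}$ (the neighbours of $P$ in $G'_{\mathrm{hor}}$).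
   Context: Graphs are simple, unweighted, locally finite; $G'$ and $F$ are connected. Graph bundles: given graphs $G',F$ and a map $\sigma$ assigning to each oriented edge $(x,y)$ of $G'$ an automorphism $\sigma_{xy}\in\operatorname{Aut}(F)$ with $\sigma_{yx}=\sigma_{xy}^{-1}$, the $F$-bundle $G'\square_\sigma F$ over $G'$ has vertex set $V(G')\times V(F)$ and edges $(x,u)\sim(y,\sigma_{xy}(u))$ whenever $x\sim y$ in $G'$ (horizontal edges), and $(x,u)\sim(x,v)$ whenever $u\sim v$ in $F$ (fiber edges). The horizontal subgraph $G'_{\mathrm{hor}}$ has vertex set $V(G'\square_\sigma F)$ and only the horizontal edges (it need not be connected). Curvature matrix: let $G$ be a graph, $x\in V(G)$, $S_k(x)$ the set of vertices at distance exactly $k$ from $x$, and $S_1(x)=\{y_1,\dots,y_{\deg(x)}\}$. For $i\ne j$ let $\varepsilon_{ij}=1$ if $y_i\sim y_j$ and $0$ otherwise, and $\omega_{ij}=\sum_{z\in S_2(x),\,z\sim y_i,\,z\sim y_j}\frac{1}{d_x^-(z)}$, where $d_x^-(z)=|S_1(x)\cap S_1(z)|$. Let $t_i=\sum_{j\ne i}\varepsilon_{ij}$ and $\Omega_i=\sum_{j\neq i}\omega_{ij}$. The curvature matrix $A_\infty(x)=A_\infty^G(x)$ is the symmetric $\deg(x)\times\deg(x)$ matrix with $(A_\infty(x))_{ij}=1-2\varepsilon_{ij}-2\omega_{ij}$ for $i\neq j$ and $(A_\infty(x))_{ii}=3-\frac{\deg(x)+\deg(y_i)}{2}+\frac52t_i+2\Omega_i$.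 *)

theory Defs
  imports "HOL-Library.Extended_Nat" "Jordan_Normal_Form.Matrix"
begin

record 'v sgraph =
  verts :: "'v set"
  adj :: "'v \<Rightarrow> 'v \<Rightarrow> bool"

definition neighbours :: "'v sgraph \<Rightarrow> 'v \<Rightarrow> 'v set" where
  "neighbours G x = {y \<in> verts G. adj G x y}"

definition gdegree :: "'v sgraph \<Rightarrow> 'v \<Rightarrow> nat" where
  "gdegree G x = card (neighbours G x)"

definition simple_graph :: "'v sgraph \<Rightarrow> bool" where
  "simple_graph G \<longleftrightarrow>
     (\<forall>x y. adj G x y \<longrightarrow> x \<in> verts G \<and> y \<in> verts G \<and> x \<noteq> y \<and> adj G y x)"

definition locally_finite :: "'v sgraph \<Rightarrow> bool" where
  "locally_finite G \<longleftrightarrow> (\<forall>x\<in>verts G. finite (neighbours G x))"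

definition connected_graph :: "'v sgraph \<Rightarrow> bool" where
  "connected_graph G \<longleftrightarrow>
     verts G \<noteq> {} \<and> (\<forall>x\<in>verts G. \<forall>y\<in>verts G. (adj G)\<^sup>*\<^sup>* x y)"

text \<open>The relational power counts walks of length \<open>k\<close>; vertices in different components
  have distance \<open>\<infinity>\<close>, since the infimum of the empty set of extended naturals is \<open>\<infinity>\<close>.\<close>

definition gdist :: "'v sgraph \<Rightarrow> 'v \<Rightarrow> 'v \<Rightarrow> enat" where
  "gdist G x y = (INF k\<in>{k. ((adj G) ^^ k) x y}. enat k)"

definition sphere :: "'v sgraph \<Rightarrow> nat \<Rightarrow> 'v \<Rightarrow> 'v set" where
  "sphere G k x = {y \<in> verts G. gdist G x y = enat k}"

definition graph_aut :: "'v sgraph \<Rightarrow> ('v \<Rightarrow> 'v) \<Rightarrow> bool" where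
  "graph_aut G f \<longleftrightarrow> bij_betw f (verts G) (verts G) \<and>
     (\<forall>u\<in>verts G. \<forall>v\<in>verts G. adj G (f u) (f v) \<longleftrightarrow> adj G u v)"

text \<open>Automorphisms are only relevant on the vertex set, so the requirement that
  \<open>\<sigma> y x\<close> is the inverse of \<open>\<sigma> x y\<close> is imposed there only.\<close>

definition bundle_map ::
  "'a sgraph \<Rightarrow> 'b sgraph \<Rightarrow> ('a \<Rightarrow> 'a \<Rightarrow> 'b \<Rightarrow> 'b) \<Rightarrow> bool" where
  "bundle_map G' F \<sigma> \<longleftrightarrow>
     (\<forall>x y. adj G' x y \<longrightarrow>
        graph_aut F (\<sigma> x y) \<and> (\<forall>u\<in>verts F. \<sigma> y x (\<sigma> x y u) = u))"

definition horizontal_edge ::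
  "'a sgraph \<Rightarrow> 'b sgraph \<Rightarrow> ('a \<Rightarrow> 'a \<Rightarrow> 'b \<Rightarrow> 'b) \<Rightarrow> 'a \<times> 'b \<Rightarrow> 'a \<times> 'b \<Rightarrow> bool" where
  "horizontal_edge G' F \<sigma> = (\<lambda>(x, u) (y, v). adj G' x y \<and> u \<in> verts F \<and> v = \<sigma> x y u)"

definition fiber_edge :: "'a sgraph \<Rightarrow> 'b sgraph \<Rightarrow> 'a \<times> 'b \<Rightarrow> 'a \<times> 'b \<Rightarrow> bool" where
  "fiber_edge G' F = (\<lambda>(x, u) (y, v). x \<in> verts G' \<and> x = y \<and> adj F u v)"

definition graph_bundle ::
  "'a sgraph \<Rightarrow> 'b sgraph \<Rightarrow> ('a \<Rightarrow> 'a \<Rightarrow> 'b \<Rightarrow> 'b) \<Rightarrow> ('a \<times> 'b) sgraph" where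
  "graph_bundle G' F \<sigma> =
     \<lparr>verts = verts G' \<times> verts F,
      adj = (\<lambda>P Q. horizontal_edge G' F \<sigma> P Q \<or> fiber_edge G' F P Q)\<rparr>"

definition horizontal_subgraph ::
  "'a sgraph \<Rightarrow> 'b sgraph \<Rightarrow> ('a \<Rightarrow> 'a \<Rightarrow> 'b \<Rightarrow> 'b) \<Rightarrow> ('a \<times> 'b) sgraph" where
  "horizontal_subgraph G' F \<sigma> =
     \<lparr>verts = verts G' \<times> verts F, adj = horizontal_edge G' F \<sigma>\<rparr>"

text \<open>The curvature matrix at \<open>x\<close> depends on an ordering \<open>y\<^sub>1, \<dots>, y\<^sub>n\<close> of the sphere of
  radius one. The ordering is an explicit list argument \<open>ys\<close>, with indices starting from 0,
  and is meaningful when \<open>enumerates ys (neighbours G x)\<close> (see \<open>sphere_1\<close> below).\<close>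

definition enumerates :: "'v list \<Rightarrow> 'v set \<Rightarrow> bool" where
  "enumerates ys S \<longleftrightarrow> distinct ys \<and> set ys = S"

definition curv_eps :: "'v sgraph \<Rightarrow> 'v list \<Rightarrow> nat \<Rightarrow> nat \<Rightarrow> real" where
  "curv_eps G ys i j = (if adj G (ys ! i) (ys ! j) then 1 else 0)"

definition in_degree :: "'v sgraph \<Rightarrow> 'v \<Rightarrow> 'v \<Rightarrow> nat" where
  "in_degree G x z = card (sphere G 1 x \<inter> sphere G 1 z)"

definition curv_omega :: "'v sgraph \<Rightarrow> 'v \<Rightarrow> 'v list \<Rightarrow> nat \<Rightarrow> nat \<Rightarrow> real" where
  "curv_omega G x ys i j =
     (\<Sum>z \<in> {z \<in> sphere G 2 x. adj G z (ys ! i) \<and> adj G z (ys ! j)}. 1 / real (in_degree G x z))"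

definition curv_t :: "'v sgraph \<Rightarrow> 'v list \<Rightarrow> nat \<Rightarrow> real" where
  "curv_t G ys i = (\<Sum>j \<in> {..<length ys} - {i}. curv_eps G ys i j)"

definition curv_Omega :: "'v sgraph \<Rightarrow> 'v \<Rightarrow> 'v list \<Rightarrow> nat \<Rightarrow> real" where
  "curv_Omega G x ys i = (\<Sum>j \<in> {..<length ys} - {i}. curv_omega G x ys i j)"

definition curvature_matrix :: "'v sgraph \<Rightarrow> 'v \<Rightarrow> 'v list \<Rightarrow> real mat" where
  "curvature_matrix G x ys = mat (length ys) (length ys) (\<lambda>(i, j).
     if i = j
     then 3 - (real (gdegree G x) + real (gdegree G (ys ! i))) / 2
            + 5 / 2 * curv_t G ys i + 2 * curv_Omega G x ys i
     else 1 - 2 * curv_eps G ys i j - 2 * curv_omega G x ys i j)"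

lemma gdist_eq_enat_iff:
  "gdist G x y = enat k \<longleftrightarrow> ((adj G) ^^ k) x y \<and> (\<forall>j<k. \<not> ((adj G) ^^ j) x y)"
proof -
  define K where "K = {k. ((adj G) ^^ k) x y}"
  have *: "gdist G x y = enat (LEAST k. k \<in> K)" if "K \<noteq> {}"
  proof -
    have "(LEAST k. k \<in> K) \<in> K" using that by (metis LeastI ex_in_conv)
    then show ?thesis
      unfolding gdist_def K_def[symmetric]
      by (intro antisym INF_lower INF_greatest) (auto intro: Least_le)
  qed
  show ?thesis
  proof (cases "K = {}")
    case True
    then have "gdist G x y = \<infinity>" unfolding gdist_def K_def[symmetric]
      by (simp add: top_enat_def)
    with True show ?thesis by (auto simp: K_def)
  next
    case False
    then have "(LEAST k. k \<in> K) \<in> K" by (metis LeastI ex_in_conv)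
    then have "(LEAST k. k \<in> K) = k \<longleftrightarrow> k \<in> K \<and> (\<forall>j<k. j \<notin> K)"
      by (metis not_less_Least linorder_neqE_nat)
    with *[OF False] show ?thesis by (simp add: K_def)
  qed
qed

lemma sphere_1:
  assumes "simple_graph G"
  shows "sphere G 1 x = neighbours G x"
  using assms unfolding sphere_def neighbours_def gdist_eq_enat_iff simple_graph_def
  by auto

lemma simple_graph_bundle:
  assumes "simple_graph G'" "simple_graph F" "bundle_map G' F \<sigma>"
  shows "simple_graph (graph_bundle G' F \<sigma>)" "simple_graph (horizontal_subgraph G' F \<sigma>)"
proof -
  have "\<sigma> x y u \<in> verts F" if "adj G' x y" "u \<in> verts F" for x y u
    using assms(3) that unfolding bundle_map_def graph_aut_def by (meson bij_betw_apply)
  with assms show "simple_graph (graph_bundle G' F \<sigma>)"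
    "simple_graph (horizontal_subgraph G' F \<sigma>)"
    unfolding simple_graph_def graph_bundle_def horizontal_subgraph_def horizontal_edge_def
      fiber_edge_def bundle_map_def
    by auto
qed

end

theory Submission
  imports Defs
begin

text \<open>Every entry of the curvature matrix at \<open>P = (x, u)\<close> is determined by degrees and by common
  neighbours of vertices at distance at most two. The proof therefore rests on a description of
  the common neighbours, in the bundle \<open>X\<close>, of the two distinct ends of a path with two edges.

  \<^item> Two distinct vertices of one fiber have all their common neighbours in that fiber, because a
    vertex has only one horizontal neighbour over each adjacent vertex of \<open>G'\<close>
    (\<open>common_neighbours_in_fiber\<close>).
  \<^item> If both edges are horizontal, all common neighbours are horizontal
    (\<open>common_neighbours_of_horizontal_path\<close>): a fiber edge at one end would close up a triangle of
    \<open>G'\<close> whose holonomy sends a vertex of \<open>F\<close> to one of its neighbours.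
  \<^item> If one edge is horizontal and the other a fiber edge, the two ends are opposite corners of a
    square, and again by the holonomy condition the other two corners are their only common
    neighbours (\<open>common_neighbours_of_mixed_path\<close>).

  The first two facts, applied once to a pair of neighbours of \<open>P\<close> and once to \<open>P\<close> and a vertex of
  the second sphere, show that \<open>\<omega>\<close> inside each block is that of \<open>F\<close> or of the horizontal graph;
  for \<open>\<epsilon>\<close> this holds because fiber neighbours of \<open>P\<close> lie over one vertex of \<open>G'\<close> and horizontal ones
  over different vertices. For a fiber neighbour and a horizontal neighbour of \<open>P\<close>, the square through
  them contributes the single vertex \<open>z\<close> with \<open>d\<^sub>P\<^sup>-(z) = 2\<close>, hence \<open>\<omega> = 1/2\<close> and
  \<open>\<epsilon> = 0\<close>, and the entry \<open>1 - 2\<epsilon> - 2\<omega>\<close> vanishes.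

  On the diagonal, let \<open>m = deg\<^sub>F u\<close> and \<open>n = deg\<^sub>G\<^sub>' x\<close>. At a fiber neighbour, passing from
  \<open>F\<close> to \<open>X\<close> raises both degrees by \<open>n\<close>, which costs \<open>n\<close>; the \<open>n\<close> mixed squares raise \<open>\<Omega>\<close> by
  \<open>n/2\<close>, which gives \<open>n\<close> back. At a horizontal neighbour the same cancellation takes place with
  \<open>m\<close>, since transport preserves degrees in \<open>F\<close>.\<close>

section \<open>Spheres of radius two\<close>

lemma relpowp_2_iff: "(R ^^ 2) a b \<longleftrightarrow> (\<exists>c. R a c \<and> R c b)"
  by (auto simp: numeral_2_eq_2 relcompp_apply)

lemma sphere_2_iff:
  assumes "simple_graph G"
  shows "z \<in> sphere G 2 p \<longleftrightarrow> z \<noteq> p \<and> \<not> adj G p z \<and> (\<exists>q. adj G p q \<and> adj G q z)"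
proof -
  have "(\<forall>j<2. \<not> (adj G ^^ j) p z) \<longleftrightarrow> z \<noteq> p \<and> \<not> adj G p z"
    by (auto simp: less_2_cases_iff)
  then show ?thesis
    using assms unfolding sphere_def gdist_eq_enat_iff relpowp_2_iff simple_graph_def by blast
qed

text \<open>This turns \<open>d\<^sub>p\<^sup>-(z)\<close> into a count of common neighbours, so that the same lemmas serve both
  for the summation range of \<open>\<omega>\<close> and for its weights.\<close>

lemma in_degree_eq_card_common_neighbours:
  assumes "simple_graph G"
  shows "in_degree G p z = card {q. adj G q p \<and> adj G q z}"
proof -
  have "sphere G 1 p \<inter> sphere G 1 z = {q. adj G q p \<and> adj G q z}"
    using assms unfolding sphere_1[OF assms] neighbours_def simple_graph_def by blast
  then show ?thesis by (simp add: in_degree_def)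
qed

text \<open>This is \<open>\<omega>\<close> as a function of two vertices instead of two positions in a list, which makes it
  independent of the enumeration of the neighbours.\<close>

definition overlap :: "'c sgraph \<Rightarrow> 'c \<Rightarrow> 'c \<Rightarrow> 'c \<Rightarrow> real" where
  "overlap G p q r = (\<Sum>z \<in> {z \<in> sphere G 2 p. adj G z q \<and> adj G z r}. 1 / real (in_degree G p z))"

lemma curv_omega_eq_overlap: "curv_omega G p ys i j = overlap G p (ys ! i) (ys ! j)"
  by (simp add: curv_omega_def overlap_def)

section \<open>Two-step paths in the bundle\<close>

locale untwisted_bundle =
  fixes G' :: "'a sgraph" and F :: "'b sgraph" and \<sigma> :: "'a \<Rightarrow> 'a \<Rightarrow> 'b \<Rightarrow> 'b"
  assumes simple_base: "simple_graph G'" and simple_fiber: "simple_graph F"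
    and bundle_transport: "bundle_map G' F \<sigma>"
    and finite_base: "locally_finite G'" and finite_fiber: "locally_finite F"
    and triangle: "\<lbrakk>adj G' a b; adj G' b c; adj G' c a; w \<in> verts F\<rbrakk> \<Longrightarrow>
           \<not> adj F w ((\<sigma> c a \<circ> \<sigma> b c \<circ> \<sigma> a b) w)"
begin

abbreviation "X \<equiv> graph_bundle G' F \<sigma>"
abbreviation "H \<equiv> horizontal_subgraph G' F \<sigma>"

lemma simple_X: "simple_graph X" and simple_H: "simple_graph H"
  using simple_graph_bundle[OF simple_base simple_fiber bundle_transport] by auto

lemma base_adj:
  assumes "adj G' a b"
  shows "a \<in> verts G'" "b \<in> verts G'" "a \<noteq> b" "adj G' b a"
  using simple_base assms unfolding simple_graph_def by auto

lemma base_irrefl [simp]: "\<not> adj G' a a"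
  using base_adj(3) by blast

lemma fiber_adj:
  assumes "adj F v w"
  shows "v \<in> verts F" "w \<in> verts F" "v \<noteq> w" "adj F w v"
  using simple_fiber assms unfolding simple_graph_def by auto

lemma transport_closed: "adj G' a b \<Longrightarrow> v \<in> verts F \<Longrightarrow> \<sigma> a b v \<in> verts F"
  using bundle_transport unfolding bundle_map_def graph_aut_def by (meson bij_betw_apply)

lemma transport_inverse: "adj G' a b \<Longrightarrow> v \<in> verts F \<Longrightarrow> \<sigma> b a (\<sigma> a b v) = v"
  using bundle_transport unfolding bundle_map_def by blast

lemma transport_adj_iff:
  "adj G' a b \<Longrightarrow> v \<in> verts F \<Longrightarrow> w \<in> verts F \<Longrightarrow> adj F (\<sigma> a b v) (\<sigma> a b w) \<longleftrightarrow> adj F v w"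
  using bundle_transport unfolding bundle_map_def graph_aut_def by blast

lemma transport_eq_iff:
  "adj G' a b \<Longrightarrow> v \<in> verts F \<Longrightarrow> w \<in> verts F \<Longrightarrow> \<sigma> a b v = \<sigma> a b w \<longleftrightarrow> v = w"
  by (metis transport_inverse)

lemma adj_H_iff: "adj H (a, v) (b, w) \<longleftrightarrow> adj G' a b \<and> v \<in> verts F \<and> w = \<sigma> a b v"
  by (simp add: horizontal_subgraph_def horizontal_edge_def)

lemma adj_X_iff:
  "adj X (a, v) (b, w) \<longleftrightarrow> adj H (a, v) (b, w) \<or> (a \<in> verts G' \<and> a = b \<and> adj F v w)"
  by (simp add: horizontal_subgraph_def graph_bundle_def fiber_edge_def)

lemma adj_X_sym: "adj X p q \<Longrightarrow> adj X q p" and adj_H_sym: "adj H p q \<Longrightarrow> adj H q p"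
  using simple_X simple_H unfolding simple_graph_def by blast+

lemma adj_H_imp_adj_X: "adj H p q \<Longrightarrow> adj X p q"
  by (cases p; cases q) (simp add: adj_X_iff)

text \<open>The holonomy condition in the form in which it is used: the two routes from \<open>a\<close> to \<open>c\<close> along
  the sides of a triangle never lead to adjacent vertices. Moving both end points back to the fiber
  over \<open>a\<close> compares \<open>v\<close> with its image under the holonomy of the triangle.\<close>

lemma transports_not_adj:
  assumes "adj G' a b" "adj G' b c" "adj G' a c" "v \<in> verts F"
  shows "\<not> adj F (\<sigma> b c (\<sigma> a b v)) (\<sigma> a c v)"
proof
  assume *: "adj F (\<sigma> b c (\<sigma> a b v)) (\<sigma> a c v)"
  have ca: "adj G' c a" using assms base_adj by blast
  have "adj F (\<sigma> c a (\<sigma> b c (\<sigma> a b v))) v"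
    using transport_adj_iff[OF ca, of "\<sigma> b c (\<sigma> a b v)" "\<sigma> a c v"] * fiber_adj[OF *]
      transport_inverse[of a c v] assms by simp
  then show False using triangle[OF assms(1,2) ca assms(4)] fiber_adj(4) by auto
qed

text \<open>If the two transports agreed, the other route from \<open>v\<close> would end next to this common
  point, as the direct transport preserves the edge between \<open>v\<close> and \<open>w\<close>.\<close>

lemma transports_of_adjacent_distinct:
  assumes "adj G' a b" "adj G' b c" "adj G' a c" "adj F v w"
  shows "\<sigma> b c (\<sigma> a b v) \<noteq> \<sigma> a c w"
  using transports_not_adj[OF assms(1-3), of v] transport_adj_iff[OF assms(3), of w v]
    fiber_adj[OF assms(4)] assms(4) by metis

text \<open>A neighbour outside the fiber over \<open>a\<close> would be joined to both vertices by horizontal edges,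
  and the transport gives each vertex just one horizontal neighbour over \<open>a\<close>.\<close>

lemma common_neighbours_in_fiber:
  assumes "v \<in> verts F" "w \<in> verts F" "v \<noteq> w" "a \<in> verts G'"
  shows "adj X z (a, v) \<and> adj X z (a, w) \<longleftrightarrow> (\<exists>r. z = (a, r) \<and> adj F r v \<and> adj F r w)"
    (is "?L \<longleftrightarrow> ?R")
proof
  assume L: ?L
  obtain b r where z: "z = (b, r)" by fastforce
  have "\<not> adj G' b a"
  proof
    assume ba: "adj G' b a"
    then have "b \<noteq> a" using base_adj by blast
    with L have "v = \<sigma> b a r" "w = \<sigma> b a r" by (auto simp: z adj_X_iff adj_H_iff)
    with assms(3) show False by simp
  qed
  with L show ?R by (auto simp: z adj_X_iff adj_H_iff)
next
  assume ?R
  with assms show ?L by (auto simp: adj_X_iff)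
qed

text \<open>A vertex has one horizontal neighbour over each adjacent base vertex. So vertices joined by a
  horizontal path of length two are never joined by a fiber edge.\<close>

lemma horizontal_path_fst_distinct:
  assumes "adj H p q" "adj H p r" "q \<noteq> r"
  shows "fst q \<noteq> fst r"
  using assms by (cases p; cases q; cases r) (auto simp: adj_H_iff)

lemma common_neighbours_of_horizontal_path:
  assumes "adj H p q" "adj H p r" "q \<noteq> r"
  shows "adj X z q \<and> adj X z r \<longleftrightarrow> adj H z q \<and> adj H z r"
proof -
  \<comment> \<open>If \<open>z\<close> is joined to \<open>q\<close> by a fiber edge, it lies over the same vertex \<open>b\<close> as \<open>q\<close>, so its edge
    to \<open>r\<close> is horizontal. Then \<open>z\<close> is the transport of \<open>p\<close> along \<open>a\<close>, \<open>c\<close>, \<open>b\<close> and \<open>q\<close> is the direct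
    one, but the two are adjacent.\<close>
  have no_fiber: "adj H z q" if *: "adj H p q" "adj H p r" "q \<noteq> r" "adj X z q" "adj X z r" for q r
  proof (rule ccontr)
    assume nH: "\<not> adj H z q"
    obtain a v where p: "p = (a, v)" by fastforce
    obtain b w where z: "z = (b, w)" by fastforce
    have q: "q = (b, \<sigma> a b v)" and ab: "adj G' a b" and v: "v \<in> verts F"
      and wq: "adj F w (\<sigma> a b v)"
      using * nH by (cases q; auto simp: p z adj_X_iff adj_H_iff)+
    obtain c where r: "r = (c, \<sigma> a c v)" and ac: "adj G' a c"
      using * by (cases r) (auto simp: p adj_H_iff)
    have "c \<noteq> b" using * q r by auto
    then have bc: "adj G' b c" and w: "\<sigma> b c w = \<sigma> a c v"
      using * by (auto simp: r z adj_X_iff adj_H_iff)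
    have "w = \<sigma> c b (\<sigma> a c v)"
      using transport_inverse[OF bc, of w] fiber_adj(1)[OF wq] w by simp
    then show False
      using transports_not_adj[OF ac base_adj(4)[OF bc] ab v] wq by simp
  qed
  show ?thesis
    using no_fiber[of q r] no_fiber[of r q] assms adj_H_imp_adj_X by blast
qed

text \<open>The vertices \<open>(a, v)\<close>, \<open>(a, w)\<close>, \<open>(b, \<sigma> a b w)\<close>, \<open>(b, \<sigma> a b v)\<close> form a square in this cyclic
  order. A common neighbour of opposite corners lying over \<open>a\<close> or \<open>b\<close> is a corner, since transport is
  invertible; one over a third vertex \<open>c\<close> would give a triangle \<open>a\<close>, \<open>c\<close>, \<open>b\<close> along which the transport
  of \<open>v\<close> meets the direct transport of its neighbour \<open>w\<close>. Exchanging \<open>v\<close> and \<open>w\<close> gives the other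
  diagonal of the same square.\<close>

lemma common_neighbours_of_mixed_path:
  assumes ab: "adj G' a b" and vw: "adj F v w"
  shows "{z. adj X z (a, v) \<and> adj X z (b, \<sigma> a b w)} = {(a, w), (b, \<sigma> a b v)}"
proof (intro Set.set_eqI iffI)
  fix z assume "z \<in> {z. adj X z (a, v) \<and> adj X z (b, \<sigma> a b w)}"
  then have z1: "adj X z (a, v)" and z2: "adj X z (b, \<sigma> a b w)" by auto
  note V = fiber_adj[OF vw] and A = base_adj[OF ab]
  obtain c r where z: "z = (c, r)" by fastforce
  consider "c = a" | "c = b" | "c \<noteq> a" "c \<noteq> b" by blast
  then show "z \<in> {(a, w), (b, \<sigma> a b v)}"
  proof cases
    case 1
    then have "r \<in> verts F" "\<sigma> a b r = \<sigma> a b w"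
      using z2 A by (auto simp: z adj_X_iff adj_H_iff)
    then show ?thesis using transport_eq_iff[OF ab] V 1 z by auto
  next
    case 2
    then have "r \<in> verts F" "v = \<sigma> b a r"
      using z1 A by (auto simp: z adj_X_iff adj_H_iff)
    then show ?thesis using transport_inverse[OF A(4)] 2 z by auto
  next
    case 3
    then have ca: "adj G' c a" "v = \<sigma> c a r" and cb: "adj G' c b" "\<sigma> a b w = \<sigma> c b r"
      and r: "r \<in> verts F"
      using z1 z2 by (auto simp: z adj_X_iff adj_H_iff)
    have "r = \<sigma> a c v" using ca transport_inverse r by simp
    then have "\<sigma> c b (\<sigma> a c v) = \<sigma> a b w" using cb by simp
    then show ?thesis
      using transports_of_adjacent_distinct[OF base_adj(4)[OF ca(1)] cb(1) ab vw] by blast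
  qed
next
  fix z assume "z \<in> {(a, w), (b, \<sigma> a b v)}"
  then show "z \<in> {z. adj X z (a, v) \<and> adj X z (b, \<sigma> a b w)}"
    using transport_adj_iff[OF ab, of v w] transport_inverse[OF ab, of v]
      transport_closed[OF ab, of v] fiber_adj[OF vw] base_adj[OF ab] ab vw
    by (auto simp: adj_X_iff adj_H_iff)
qed

lemma not_adj_mixed_path:
  assumes "adj G' a b" "adj F v w"
  shows "\<not> adj X (a, v) (b, \<sigma> a b w)"
  using transport_eq_iff[OF assms(1), of v w] base_adj[OF assms(1)] fiber_adj[OF assms(2)]
  by (auto simp: adj_X_iff adj_H_iff)

section \<open>Entries of the curvature matrix\<close>

text \<open>The vertices of the second sphere that enter the sum, and the sets counted by their in-degrees,
  are images under \<open>Pair x\<close> of the corresponding sets in \<open>F\<close>.\<close>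

lemma overlap_fiber:
  assumes x: "x \<in> verts G'" and "adj F u v" "adj F u w" "v \<noteq> w"
  shows "overlap X (x, u) (x, v) (x, w) = overlap F u v w"
proof -
  note V = fiber_adj[OF assms(2)] fiber_adj[OF assms(3)]
  have deg: "in_degree X (x, u) (x, r) = in_degree F u r" if "r \<in> verts F" "u \<noteq> r" for r
  proof -
    have "{q. adj X q (x, u) \<and> adj X q (x, r)} = Pair x ` {s. adj F s u \<and> adj F s r}"
      using common_neighbours_in_fiber[OF _ that(1,2) x] V by auto
    then show ?thesis
      by (simp add: in_degree_eq_card_common_neighbours simple_X simple_fiber card_image inj_on_def)
  qed
  have sph: "(x, r) \<in> sphere X 2 (x, u) \<longleftrightarrow> r \<in> sphere F 2 u" if "adj F r v" for r
  proof -
    have "adj X (x, u) (x, v)" "adj X (x, v) (x, r)"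
      using x assms(2) fiber_adj[OF that] by (auto simp: adj_X_iff)
    moreover have "adj X (x, u) (x, r) \<longleftrightarrow> adj F u r"
      using x base_adj by (auto simp: adj_X_iff adj_H_iff)
    ultimately show ?thesis
      using assms(2) fiber_adj[OF that] unfolding sphere_2_iff[OF simple_X] sphere_2_iff[OF simple_fiber]
      by auto
  qed
  have set: "{z \<in> sphere X 2 (x, u). adj X z (x, v) \<and> adj X z (x, w)}
    = Pair x ` {r \<in> sphere F 2 u. adj F r v \<and> adj F r w}"
    using common_neighbours_in_fiber[OF _ _ assms(4) x] V sph by auto
  have "in_degree X (x, u) (x, r) = in_degree F u r" if "r \<in> sphere F 2 u" for r
  proof -
    have "u \<noteq> r" "\<exists>s. adj F s r" using that by (auto simp: sphere_2_iff[OF simple_fiber])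
    then show ?thesis using deg fiber_adj(2) by blast
  qed
  then show ?thesis
    unfolding overlap_def set by (subst sum.reindex) (auto simp: inj_on_def)
qed

text \<open>The path from \<open>q\<close> to \<open>r\<close> through \<open>p\<close> identifies the summation ranges, and the path from \<open>p\<close> to \<open>z\<close>
  through \<open>q\<close> identifies the weights.\<close>

lemma overlap_horizontal:
  assumes pq: "adj H p q" and pr: "adj H p r" and "q \<noteq> r"
  shows "overlap X p q r = overlap H p q r"
  unfolding overlap_def
proof (rule sum.cong)
  show "{z \<in> sphere X 2 p. adj X z q \<and> adj X z r} = {z \<in> sphere H 2 p. adj H z q \<and> adj H z r}"
  proof -
    have "z \<in> sphere X 2 p \<longleftrightarrow> z \<in> sphere H 2 p" if "adj H z q" for z
    proof -
      have "adj X p z \<longleftrightarrow> adj H p z" if "z \<noteq> p"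
        using horizontal_path_fst_distinct[of q p z] that \<open>adj H z q\<close> pq adj_H_sym
        by (cases p; cases z) (auto simp: adj_X_iff)
      then show ?thesis
        using pq that adj_H_sym adj_H_imp_adj_X unfolding sphere_2_iff[OF simple_X] sphere_2_iff[OF simple_H]
        by blast
    qed
    then show ?thesis using common_neighbours_of_horizontal_path[OF assms] by blast
  qed
next
  fix z assume "z \<in> {z \<in> sphere H 2 p. adj H z q \<and> adj H z r}"
  then have "adj H q z" "z \<noteq> p" using adj_H_sym by (auto simp: sphere_2_iff[OF simple_H])
  then have "{s. adj X s p \<and> adj X s z} = {s. adj H s p \<and> adj H s z}"
    using common_neighbours_of_horizontal_path[OF adj_H_sym[OF pq], of z] by auto
  then show "1 / real (in_degree X p z) = 1 / real (in_degree H p z)"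
    by (simp add: in_degree_eq_card_common_neighbours simple_X simple_H)
qed

text \<open>Both diagonals of the square are used: the one through \<open>(x, v)\<close> and \<open>(y, \<sigma> x y u)\<close> leaves the
  opposite corner of \<open>(x, u)\<close> as the only summand, and the other one shows that its weight is
  \<open>1/2\<close>.\<close>

lemma overlap_mixed:
  assumes xy: "adj G' x y" and uv: "adj F u v"
  shows "overlap X (x, u) (x, v) (y, \<sigma> x y u) = 1 / 2"
proof -
  note V = fiber_adj[OF uv] and A = base_adj[OF xy]
  let ?z = "(y, \<sigma> x y v)"
  have corners: "{z. adj X z (x, v) \<and> adj X z (y, \<sigma> x y u)} = {(x, u), ?z}"
    by (rule common_neighbours_of_mixed_path[OF xy V(4)])
  have common: "{z. adj X z (x, u) \<and> adj X z ?z} = {(x, v), (y, \<sigma> x y u)}"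
    by (rule common_neighbours_of_mixed_path[OF xy uv])
  have "?z \<in> sphere X 2 (x, u)"
    using corners common not_adj_mixed_path[OF xy uv] A adj_X_sym
    unfolding sphere_2_iff[OF simple_X] by blast
  moreover have "(x, u) \<notin> sphere X 2 (x, u)" by (simp add: sphere_2_iff[OF simple_X])
  moreover have "{z \<in> sphere X 2 (x, u). adj X z (x, v) \<and> adj X z (y, \<sigma> x y u)}
      = {(x, u), ?z} \<inter> sphere X 2 (x, u)"
    unfolding corners[symmetric] by blast
  ultimately have "{z \<in> sphere X 2 (x, u). adj X z (x, v) \<and> adj X z (y, \<sigma> x y u)} = {?z}"
    by simp
  moreover have "in_degree X (x, u) ?z = 2"
    using A by (simp add: in_degree_eq_card_common_neighbours[OF simple_X] common)
  ultimately show ?thesis by (simp add: overlap_def)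
qed


section \<open>Degrees\<close>

lemma neighbours_H:
  "v \<in> verts F \<Longrightarrow> neighbours H (a, v) = (\<lambda>b. (b, \<sigma> a b v)) ` neighbours G' a"
  using transport_closed base_adj unfolding neighbours_def
  by (auto simp: adj_H_iff image_iff) (auto simp: horizontal_subgraph_def)

lemma neighbours_X:
  assumes "a \<in> verts G'" "v \<in> verts F"
  shows "neighbours X (a, v) = Pair a ` neighbours F v \<union> neighbours H (a, v)"
  using assms fiber_adj base_adj unfolding neighbours_def
  by (auto simp: adj_X_iff image_iff) (auto simp: horizontal_subgraph_def graph_bundle_def)

lemma fiber_horizontal_disjoint: "Pair a ` neighbours F v \<inter> neighbours H (a, v) = {}"
  using base_adj by (auto simp: neighbours_def adj_H_iff)

lemma gdegree_H: "v \<in> verts F \<Longrightarrow> gdegree H (a, v) = gdegree G' a"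
  by (simp add: gdegree_def neighbours_H card_image inj_on_def)

lemma gdegree_X:
  assumes "a \<in> verts G'" "v \<in> verts F"
  shows "gdegree X (a, v) = gdegree F v + gdegree H (a, v)"
proof -
  have "finite (neighbours F v)" "finite (neighbours H (a, v))"
    using assms finite_base finite_fiber by (auto simp: locally_finite_def neighbours_H)
  then show ?thesis
    unfolding gdegree_def neighbours_X[OF assms]
    using fiber_horizontal_disjoint[of a v] by (simp add: card_Un_disjoint card_image inj_on_def)
qed

lemma gdegree_transport:
  assumes "adj G' a b" "v \<in> verts F"
  shows "gdegree F (\<sigma> a b v) = gdegree F v"
proof -
  note ba = base_adj(4)[OF assms(1)]
  have "neighbours F (\<sigma> a b v) = \<sigma> a b ` neighbours F v"
  proof (intro Set.set_eqI iffI)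
    fix w assume w: "w \<in> neighbours F (\<sigma> a b v)"
    then have "w \<in> verts F" by (simp add: neighbours_def)
    then have "w = \<sigma> a b (\<sigma> b a w)" "\<sigma> b a w \<in> verts F"
      using transport_inverse[OF ba] transport_closed[OF ba] by simp_all
    then show "w \<in> \<sigma> a b ` neighbours F v"
      using w transport_adj_iff[OF assms, of "\<sigma> b a w"] unfolding neighbours_def by auto
  qed (use assms in \<open>auto simp: neighbours_def transport_closed transport_adj_iff\<close>)
  moreover have "inj_on (\<sigma> a b) (neighbours F v)"
    using assms transport_eq_iff by (auto simp: inj_on_def neighbours_def)
  ultimately show ?thesis by (simp add: gdegree_def card_image)
qed

end

section \<open>Assembling the blocks\<close>

lemma sum_except_split:
  fixes f :: "nat \<Rightarrow> 'r::comm_monoid_add"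
  shows sum_except_left: "i < m \<Longrightarrow> (\<Sum>j \<in> {..<m + n} - {i}. f j) =
      (\<Sum>j \<in> {..<m} - {i}. f j) + (\<Sum>j<n. f (m + j))"
    and sum_except_right: "i < n \<Longrightarrow> (\<Sum>j \<in> {..<m + n} - {m + i}. f j) =
      (\<Sum>j<m. f j) + (\<Sum>j \<in> {..<n} - {i}. f (m + j))"
proof -
  have split: "{..<m + n} = {..<m} \<union> (+) m ` {..<n}"
    by (simp add: lessThan_atLeast0 image_add_atLeastLessThan ivl_disj_un_two(3) add.commute)
  have shift: "sum f ((+) m ` S) = (\<Sum>j\<in>S. f (m + j))" for S
    by (simp add: sum.reindex)
  show "(\<Sum>j \<in> {..<m + n} - {i}. f j) = (\<Sum>j \<in> {..<m} - {i}. f j) + (\<Sum>j<n. f (m + j))"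
    if "i < m"
  proof -
    have "{..<m + n} - {i} = ({..<m} - {i}) \<union> (+) m ` {..<n}" using that by (auto simp: split)
    then show ?thesis by (simp add: shift[symmetric]) (rule sum.union_disjoint; auto)
  qed
  show "(\<Sum>j \<in> {..<m + n} - {m + i}. f j) = (\<Sum>j<m. f j) + (\<Sum>j \<in> {..<n} - {i}. f (m + j))"
    if "i < n"
  proof -
    have "{..<m + n} - {m + i} = {..<m} \<union> (+) m ` ({..<n} - {i})" using that by (auto simp: split)
    then show ?thesis by (simp add: shift[symmetric]) (rule sum.union_disjoint; auto)
  qed
qed

context untwisted_bundle
begin

text \<open>In the proof, the indices below \<open>m\<close> belong to the fiber neighbours and those of the form
  \<open>m + i\<close> to the horizontal ones; the suffixes \<open>f\<close> and \<open>h\<close> of the local facts name the kinds of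
  the two indices.\<close>

lemma curvature_matrix_decomposes:
  assumes x: "x \<in> verts G'" and u: "u \<in> verts F"
    and us: "enumerates us (neighbours F u)" and hs: "enumerates hs (neighbours H (x, u))"
  shows "curvature_matrix X (x, u) (map (Pair x) us @ hs) =
    diag_block_mat [curvature_matrix F u us, curvature_matrix H (x, u) hs]"
proof -
  define m n ys where "m = length us" and "n = length hs" and "ys = map (Pair x) us @ hs"
  have len: "length ys = m + n" by (simp add: ys_def m_def n_def)
  have ys_left: "ys ! i = (x, us ! i)" if "i < m" for i
    using that by (simp add: ys_def m_def nth_append)
  have ys_right: "ys ! (m + i) = hs ! i" for i
    by (simp add: ys_def m_def nth_append)
  have us_adj: "adj F u (us ! i)" if "i < m" for i
    using us that unfolding enumerates_def neighbours_def m_def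
    by (metis (mono_tags, lifting) mem_Collect_eq nth_mem)
  have us_eq: "us ! i = us ! j \<longleftrightarrow> i = j" if "i < m" "j < m" for i j
    using us that by (simp add: enumerates_def m_def nth_eq_iff_index_eq)
  have hs_adj: "adj H (x, u) (hs ! i)" if "i < n" for i
    using hs that unfolding enumerates_def neighbours_def n_def
    by (metis (mono_tags, lifting) mem_Collect_eq nth_mem)
  have hs_eq: "hs ! i = hs ! j \<longleftrightarrow> i = j" if "i < n" "j < n" for i j
    using hs that by (simp add: enumerates_def n_def nth_eq_iff_index_eq)
  have hs_form: "\<exists>y. adj G' x y \<and> hs ! i = (y, \<sigma> x y u)" if "i < n" for i
    using hs_adj[OF that] by (cases "hs ! i") (auto simp: adj_H_iff)
  have m: "m = gdegree F u" and n: "n = gdegree H (x, u)"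
    using us hs distinct_card unfolding enumerates_def m_def n_def gdegree_def by metis+

  have eps_ff: "curv_eps X ys i j = curv_eps F us i j" if "i < m" "j < m" for i j
    using that x by (auto simp: curv_eps_def ys_left adj_X_iff adj_H_iff)
  have eps_hh: "curv_eps X ys (m + i) (m + j) = curv_eps H hs i j" if "i < n" "j < n" for i j
  proof -
    have "adj X (hs ! i) (hs ! j) \<longleftrightarrow> adj H (hs ! i) (hs ! j)"
    proof (cases "hs ! i = hs ! j")
      case True
      then show ?thesis using simple_X simple_H unfolding simple_graph_def by metis
    next
      case False
      with horizontal_path_fst_distinct[OF hs_adj[OF that(1)] hs_adj[OF that(2)]] show ?thesis
        by (cases "hs ! i"; cases "hs ! j") (auto simp: adj_X_iff)
    qed
    then show ?thesis by (simp add: curv_eps_def ys_right)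
  qed
  have eps_fh: "curv_eps X ys i (m + j) = 0" and eps_hf: "curv_eps X ys (m + j) i = 0"
    if ij: "i < m" "j < n" for i j
  proof -
    obtain y where y: "adj G' x y" "hs ! j = (y, \<sigma> x y u)" using hs_form[OF ij(2)] by blast
    have "\<not> adj X (x, us ! i) (y, \<sigma> x y u)"
      using not_adj_mixed_path[OF y(1) fiber_adj(4)[OF us_adj[OF ij(1)]]] .
    then show "curv_eps X ys i (m + j) = 0" "curv_eps X ys (m + j) i = 0"
      using adj_X_sym by (auto simp: curv_eps_def ys_left ys_right y ij)
  qed

  have om_ff: "curv_omega X (x, u) ys i j = curv_omega F u us i j" if "i < m" "j < m" "i \<noteq> j" for i j
    using overlap_fiber[OF x us_adj us_adj] us_eq that by (simp add: curv_omega_eq_overlap ys_left)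
  have om_hh: "curv_omega X (x, u) ys (m + i) (m + j) = curv_omega H (x, u) hs i j"
    if "i < n" "j < n" "i \<noteq> j" for i j
    using overlap_horizontal[OF hs_adj hs_adj] hs_eq that by (simp add: curv_omega_eq_overlap ys_right)
  have om_fh: "curv_omega X (x, u) ys i (m + j) = 1 / 2"
    and om_hf: "curv_omega X (x, u) ys (m + j) i = 1 / 2" if ij: "i < m" "j < n" for i j
  proof -
    obtain y where y: "adj G' x y" "hs ! j = (y, \<sigma> x y u)" using hs_form[OF ij(2)] by blast
    show "curv_omega X (x, u) ys i (m + j) = 1 / 2"
      using overlap_mixed[OF y(1) us_adj] ij by (simp add: curv_omega_eq_overlap ys_left ys_right y)
    then show "curv_omega X (x, u) ys (m + j) i = 1 / 2"
      by (simp add: curv_omega_def conj_commute)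
  qed

  have t_f: "curv_t X ys i = curv_t F us i" if "i < m" for i
    using that unfolding curv_t_def len sum_except_left[OF that] m_def[symmetric]
    by (simp add: eps_ff eps_fh)
  have t_h: "curv_t X ys (m + i) = curv_t H hs i" if "i < n" for i
    using that unfolding curv_t_def len sum_except_right[OF that] n_def[symmetric]
    by (simp add: eps_hh eps_hf)
  have Om_f: "curv_Omega X (x, u) ys i = curv_Omega F u us i + n / 2" if "i < m" for i
    using that unfolding curv_Omega_def len sum_except_left[OF that] m_def[symmetric]
    by (simp add: om_ff om_fh)
  have Om_h: "curv_Omega X (x, u) ys (m + i) = curv_Omega H (x, u) hs i + m / 2" if "i < n" for i
    using that unfolding curv_Omega_def len sum_except_right[OF that] n_def[symmetric]
    by (simp add: om_hh om_hf)

  have deg: "gdegree X (x, u) = m + n" using gdegree_X[OF x u] m n by simp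
  have deg_f: "gdegree X (ys ! i) = gdegree F (us ! i) + n" if "i < m" for i
    using gdegree_X[OF x] gdegree_H u fiber_adj(2)[OF us_adj[OF that]] n by (simp add: ys_left that)
  have deg_h: "gdegree X (ys ! (m + i)) = m + gdegree H (hs ! i)" if i: "i < n" for i
  proof -
    obtain y where y: "adj G' x y" "hs ! i = (y, \<sigma> x y u)" using hs_form[OF i] by blast
    show ?thesis
      unfolding ys_right y(2)
      using gdegree_X[OF base_adj(2)[OF y(1)] transport_closed[OF y(1) u]] gdegree_transport[OF y(1) u] m
      by simp
  qed

  have dims: "dim_row (curvature_matrix F u us) = m" "dim_col (curvature_matrix F u us) = m"
    "dim_row (curvature_matrix H (x, u) hs) = n" "dim_col (curvature_matrix H (x, u) hs) = n"
    by (simp_all add: curvature_matrix_def m_def n_def)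
  have "curvature_matrix X (x, u) ys =
    four_block_mat (curvature_matrix F u us) (0\<^sub>m m n) (0\<^sub>m n m) (curvature_matrix H (x, u) hs)"
    (is "?L = ?R")
  proof (rule eq_matI)
    show "dim_row ?L = dim_row ?R" "dim_col ?L = dim_col ?R"
      by (simp_all add: dims) (simp_all add: curvature_matrix_def len)
    fix i j assume "i < dim_row ?R" "j < dim_col ?R"
    then have ij: "i < m + n" "j < m + n" by (simp_all add: dims)
    consider (ff) "i < m" "j < m" | (fh) k where "i < m" "j = m + k" "k < n"
      | (hf) k where "i = m + k" "k < n" "j < m" | (hh) k l where "i = m + k" "k < n" "j = m + l" "l < n"
      using ij by (metis add.commute add_less_cancel_left le_Suc_ex linorder_not_less)
    then show "?L $$ (i, j) = ?R $$ (i, j)"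
    proof cases
      case ff
      then have "?R $$ (i, j) = curvature_matrix F u us $$ (i, j)" by (simp add: dims)
      with ff show ?thesis
        by (simp add: curvature_matrix_def len m_def[symmetric] eps_ff om_ff t_f Om_f deg deg_f m[symmetric])
          (simp add: field_simps)
    next
      case hh
      then have "?R $$ (i, j) = curvature_matrix H (x, u) hs $$ (k, l)" by (simp add: dims)
      with hh show ?thesis
        by (simp add: curvature_matrix_def len n_def[symmetric] eps_hh om_hh t_h Om_h deg deg_h n[symmetric])
          (simp add: field_simps)
    next
      case fh
      then show ?thesis by (simp add: dims) (simp add: curvature_matrix_def len eps_fh om_fh)
    next
      case hf
      then show ?thesis by (simp add: dims) (simp add: curvature_matrix_def len eps_hf om_hf)
    qed
  qed
  then show ?thesis
    unfolding ys_def diag_block_mat.simps(2)[of "curvature_matrix F u us"] diag_block_mat_singleton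
    by (simp only: Let_def dims)
qed

end

theorem proposition6p4:
  fixes G' :: "'a sgraph" and F :: "'b sgraph" and \<sigma> :: "'a \<Rightarrow> 'a \<Rightarrow> 'b \<Rightarrow> 'b"
    and x :: 'a and u :: 'b
  defines "X \<equiv> graph_bundle G' F \<sigma>"
    and "G'hor \<equiv> horizontal_subgraph G' F \<sigma>"
    and "FP \<equiv> {(x, v) | v. adj F v u}"
    and "HP \<equiv> {(y, \<sigma> x y u) | y. adj G' y x}"
  assumes "simple_graph G'" and "locally_finite G'" and "connected_graph G'"
    and "simple_graph F" and "locally_finite F" and "connected_graph F"
    and "bundle_map G' F \<sigma>"
    and "\<And>a b c w. \<lbrakk>adj G' a b; adj G' b c; adj G' c a; w \<in> verts F\<rbrakk> \<Longrightarrow>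
           \<not> adj F w ((\<sigma> c a \<circ> \<sigma> b c \<circ> \<sigma> a b) w)"
    and "(x, u) \<in> verts X"
  shows "neighbours X (x, u) = FP \<union> HP \<and> FP \<inter> HP = {} \<and>
         bij_betw (Pair x) (neighbours F u) FP \<and> neighbours G'hor (x, u) = HP \<and>
         (\<forall>us hs. enumerates us (neighbours F u) \<longrightarrow> enumerates hs HP \<longrightarrow>
            curvature_matrix X (x, u) (map (Pair x) us @ hs) =
              diag_block_mat [curvature_matrix F u us, curvature_matrix G'hor (x, u) hs])"
proof -
  interpret untwisted_bundle G' F \<sigma>
    using assms(5,6,8,9,11,12) by unfold_locales
  have x: "x \<in> verts G'" and u: "u \<in> verts F"
    using assms(13) by (simp_all add: X_def graph_bundle_def)
  have FP: "FP = Pair x ` neighbours F u"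
    using fiber_adj by (auto simp: FP_def neighbours_def)
  have HP: "HP = neighbours G'hor (x, u)"
    using base_adj neighbours_H[OF u] by (auto simp: HP_def G'hor_def neighbours_def)
  show ?thesis
    using neighbours_X[OF x u] fiber_horizontal_disjoint[of x u] curvature_matrix_decomposes[OF x u]
    unfolding FP HP unfolding X_def G'hor_def by (simp add: bij_betw_def inj_on_def)
qed

end
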